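(* Let $n\ge 2$ and $m\ge 2$ be integers. Let $\phi:\widetilde A_{n-1}\to \widetilde A_{mn-1}$ be the homomorphism given by $\phi(r_i)=\prod_{j=0}^{m-1}s_{i+jn}$ for $0\le i\le n-1$, and let $\ell$ be the length function of $\widetilde A_{mn-1}$. Then $$U^{\widetilde A_{mn-1}}_{\widetilde A_{n-1}}(q):=\sum_{w\in \widetilde A_{n-1}}q^{\ell(\phi(w))}=\prod_{k=1}^{n}[k]_{q^m}\cdot\prod_{k=2}^{n}\frac{1}{1-q^{(k-1)m}}.$$
   Context: $[k]_q:=1+q+\cdots+q^{k-1}$. For $N\ge 3$, the affine Coxeter group $\widetilde A_{N-1}$ is generated by $s_0,\dots,s_{N-1}$ (indices modulo $N$) with $s_i^2=e$, $(s_is_{i+1})^3=e$ and $(s_is_j)^2=e$ when $j\not\equiv i,i\pm1 \pmod N$; $\widetilde A_1$ is the infinite dihedral group generated by two involutions $r_0,r_1$ with no further relation. Here $\widetilde A_{n-1}$ has generators $r_0,\dots,r_{n-1}$ and $\widetilde A_{mn-1}$ has generators $s_0,\dots,s_{mn-1}$ (indices mod $mn$); the factors in $\phi(r_i)$ commute, and the assignment extends to an injective group homomorphism. *)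

theory Defs
  imports
    "HOL-Algebra.Group"
    "HOL-Analysis.Infinite_Sum"
    "HOL-Computational_Algebra.Formal_Power_Series"
begin

section \<open>Group presentations\<close>

text \<open>
  The letter \<open>(s, True)\<close> stands for the generator \<open>s\<close> and \<open>(s, False)\<close> for its formal inverse.
  The group presented by generators \<open>S\<close> and relators \<open>R\<close> consists of the words in these letters
  modulo the congruence that allows inserting and deleting \<open>s s\<^sup>-\<^sup>1\<close>, \<open>s\<^sup>-\<^sup>1 s\<close> and
  the relators.
\<close>

type_synonym 'a word = "('a \<times> bool) list"

definition words :: "'a set \<Rightarrow> 'a word set" where
  "words S = lists (S \<times> UNIV)"

inductive_set word_rel :: "'a set \<Rightarrow> 'a word set \<Rightarrow> ('a word \<times> 'a word) set"
  for S :: "'a set" and R :: "'a word set" where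
  refl: "u \<in> words S \<Longrightarrow> (u, u) \<in> word_rel S R"
| sym: "(u, v) \<in> word_rel S R \<Longrightarrow> (v, u) \<in> word_rel S R"
| trans: "(u, v) \<in> word_rel S R \<Longrightarrow> (v, w) \<in> word_rel S R \<Longrightarrow> (u, w) \<in> word_rel S R"
| cancel: "u \<in> words S \<Longrightarrow> v \<in> words S \<Longrightarrow> s \<in> S \<Longrightarrow>
    (u @ [(s, b), (s, \<not> b)] @ v, u @ v) \<in> word_rel S R"
| relator: "u \<in> words S \<Longrightarrow> v \<in> words S \<Longrightarrow> r \<in> R \<Longrightarrow> r \<in> words S \<Longrightarrow>
    (u @ r @ v, u @ v) \<in> word_rel S R"

definition presented_group :: "'a set \<Rightarrow> 'a word set \<Rightarrow> 'a word set monoid" where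
  "presented_group S R =
    \<lparr>carrier = words S // word_rel S R,
     monoid.mult = (\<lambda>A B. word_rel S R `` {u @ v | u v. u \<in> A \<and> v \<in> B}),
     one = word_rel S R `` {[]}\<rparr>"

definition presented_gen :: "'a set \<Rightarrow> 'a word set \<Rightarrow> 'a \<Rightarrow> 'a word set" where
  "presented_gen S R s = word_rel S R `` {[(s, True)]}"

definition group_list_prod :: "('g, 'b) monoid_scheme \<Rightarrow> 'g list \<Rightarrow> 'g" where
  "group_list_prod G gs = foldr (monoid.mult G) gs (one G)"

text \<open>
  Length with respect to words in \<open>S\<close> only, without inverses; it is used below for generating sets
  consisting of involutions.
\<close>

definition word_length :: "('g, 'b) monoid_scheme \<Rightarrow> 'g set \<Rightarrow> 'g \<Rightarrow> nat" where
  "word_length G S g = (LEAST k. \<exists>gs. gs \<in> lists S \<and> length gs = k \<and> group_list_prod G gs = g)"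


section \<open>Affine Coxeter groups of type A\<close>

text \<open>
  Everything is indexed by the number \<open>N\<close> of generators, so \<open>affine_A N\<close> is the affine Coxeter group
  usually denoted by a tilde over \<open>A\<close> with subscript \<open>N - 1\<close>. For \<open>N = 2\<close> only the relators
  \<open>s\<^sub>i\<^sup>2\<close> are present and the group is infinite dihedral.
\<close>

definition affine_A_relators :: "nat \<Rightarrow> nat word set" where
  "affine_A_relators N = map (\<lambda>i. (i, True)) `
    ({[i, i] | i. i < N} \<union>
     {[i, j, i, j, i, j] | i j. N \<ge> 3 \<and> i < N \<and> j = (i + 1) mod N} \<union>
     {[i, j, i, j] | i j. N \<ge> 3 \<and> i < N \<and> j < N \<and>
        j \<noteq> i \<and> j \<noteq> (i + 1) mod N \<and> i \<noteq> (j + 1) mod N})"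

definition affine_A :: "nat \<Rightarrow> nat word set monoid" where
  "affine_A N = presented_group {..<N} (affine_A_relators N)"

definition affine_A_gen :: "nat \<Rightarrow> nat \<Rightarrow> nat word set" where
  "affine_A_gen N i = presented_gen {..<N} (affine_A_relators N) (i mod N)"

definition affine_A_length :: "nat \<Rightarrow> nat word set \<Rightarrow> nat" where
  "affine_A_length N = word_length (affine_A N) (affine_A_gen N ` {..<N})"


section \<open>q-integers\<close>

definition q_int :: "nat \<Rightarrow> 'a::comm_semiring_1 \<Rightarrow> 'a" where
  "q_int k q = (\<Sum>i<k. q ^ i)"


section \<open>The presented group is a group\<close>

lemma words_simps [simp]:
  "[] \<in> words S" "x # u \<in> words S \<longleftrightarrow> fst x \<in> S \<and> u \<in> words S"
  "u @ v \<in> words S \<longleftrightarrow> u \<in> words S \<and> v \<in> words S"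
  by (cases x; auto simp: words_def)+

lemma word_rel_words: "(u, v) \<in> word_rel S R \<Longrightarrow> u \<in> words S \<and> v \<in> words S"
  by (induction rule: word_rel.induct) auto

lemma equiv_word_rel: "equiv (words S) (word_rel S R)"
  by (rule equivI)
    (auto simp: refl_on_def sym_on_def trans_on_def dest: word_rel_words
      intro: word_rel.refl word_rel.sym word_rel.trans)

lemma word_rel_context:
  "(u, v) \<in> word_rel S R \<Longrightarrow> x \<in> words S \<Longrightarrow> y \<in> words S \<Longrightarrow>
    (x @ u @ y, x @ v @ y) \<in> word_rel S R"
proof (induction rule: word_rel.induct)
  case (cancel u v s b)
  then show ?case using word_rel.cancel[of "x @ u" S "v @ y" s b R] by simp
next
  case (relator u v r)
  then show ?case using word_rel.relator[of "x @ u" S "v @ y" r R] by simp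
qed (auto intro: word_rel.refl word_rel.sym word_rel.trans)

lemma word_rel_append:
  assumes "(u, u') \<in> word_rel S R" "(v, v') \<in> word_rel S R"
  shows "(u @ v, u' @ v') \<in> word_rel S R"
  using word_rel_context[OF assms(1), of "[]" v] word_rel_context[OF assms(2), of u' "[]"]
    word_rel_words[OF assms(1)] word_rel_words[OF assms(2)]
  by (auto intro: word_rel.trans)

lemma presented_group_mult:
  assumes "u \<in> words S" "v \<in> words S"
  shows "word_rel S R `` {u} \<otimes>\<^bsub>presented_group S R\<^esub> word_rel S R `` {v} = word_rel S R `` {u @ v}"
  using assms
  by (auto simp: presented_group_def intro: word_rel.refl word_rel.trans word_rel_append)

lemma word_rel_inverse:
  "u \<in> words S \<Longrightarrow> (map (\<lambda>(s, b). (s, \<not> b)) (rev u) @ u, []) \<in> word_rel S R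
    \<and> map (\<lambda>(s, b). (s, \<not> b)) (rev u) \<in> words S"
proof (induction u)
  case (Cons x u)
  obtain s b where x: "x = (s, b)" by (cases x)
  let ?w = "map (\<lambda>(s, b). (s, \<not> b)) (rev u)"
  have *: "?w \<in> words S" "(?w @ u, []) \<in> word_rel S R" "u \<in> words S" "s \<in> S"
    using Cons x by auto
  have "(?w @ [(s, \<not> b), (s, \<not> \<not> b)] @ u, ?w @ u) \<in> word_rel S R"
    using * by (intro word_rel.cancel)
  with * show ?case by (auto simp: x intro: word_rel.trans)
qed (auto intro: word_rel.refl)

lemma group_presented_group: "group (presented_group S R)"
proof (rule groupI)
  let ?G = "presented_group S R"
  have carrier: "carrier ?G = {word_rel S R `` {u} | u. u \<in> words S}"
    by (auto simp: presented_group_def quotient_def)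
  have one: "\<one>\<^bsub>?G\<^esub> = word_rel S R `` {[]}"
    by (simp add: presented_group_def)
  show "\<one>\<^bsub>?G\<^esub> \<in> carrier ?G"
    using words_simps(1) by (auto simp: carrier one)
  show "x \<otimes>\<^bsub>?G\<^esub> y \<in> carrier ?G" if "x \<in> carrier ?G" "y \<in> carrier ?G" for x y
    using that by (force simp: carrier presented_group_mult)
  show "x \<otimes>\<^bsub>?G\<^esub> y \<otimes>\<^bsub>?G\<^esub> z = x \<otimes>\<^bsub>?G\<^esub> (y \<otimes>\<^bsub>?G\<^esub> z)"
    if "x \<in> carrier ?G" "y \<in> carrier ?G" "z \<in> carrier ?G" for x y z
    using that by (auto simp: carrier presented_group_mult)
  show "\<one>\<^bsub>?G\<^esub> \<otimes>\<^bsub>?G\<^esub> x = x" if "x \<in> carrier ?G" for x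
    using that by (auto simp: carrier one presented_group_mult)
  show "\<exists>y\<in>carrier ?G. y \<otimes>\<^bsub>?G\<^esub> x = \<one>\<^bsub>?G\<^esub>" if x: "x \<in> carrier ?G" for x
  proof -
    obtain u where u: "u \<in> words S" "x = word_rel S R `` {u}"
      using x unfolding carrier by blast
    let ?w = "map (\<lambda>(s, b). (s, \<not> b)) (rev u)"
    have w: "(?w @ u, []) \<in> word_rel S R" "?w \<in> words S"
      using word_rel_inverse[OF u(1)] by auto
    have "word_rel S R `` {?w} \<otimes>\<^bsub>?G\<^esub> x = \<one>\<^bsub>?G\<^esub>"
      using u w by (simp add: presented_group_mult one equiv_class_eq[OF equiv_word_rel])
    moreover have "word_rel S R `` {?w} \<in> carrier ?G"
      using w by (auto simp: carrier)
    ultimately show ?thesis by blast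
  qed
qed

end

theory Submission
  imports Defs
begin

text \<open>
  The affine Coxeter group with \<open>N\<close> generators acts on the tuples \<open>c\<close> of \<open>N\<close> natural numbers with
  minimum 0 (affine Lehmer codes): \<open>s\<^sub>i\<close> replaces the cyclically adjacent entries \<open>(a, b)\<close> at
  \<open>i\<close>, \<open>i + 1\<close> by \<open>(b + 1, a)\<close> if \<open>a \<le> b\<close>, and by \<open>(b, a - 1)\<close> otherwise. Every step changes
  the sum of the code by one, and every nonzero code has a descent \<open>a > b\<close>, so each code is reached
  from 0 by a word as long as its sum. Two descents can always be joined by a commutation or braid
  relation, so such a word is unique up to the relations. Hence \<open>w \<mapsto> w 0\<close> is a bijection
  from the group to the codes that turns length into sum.

  The image \<open>\<phi> (r\<^sub>i)\<close> acts on the \<open>m\<close>-fold repetition of a code of \<open>n\<close> entries as \<open>r\<^sub>i\<close> acts on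
  the code itself, so \<open>\<phi>\<close> multiplies the length by \<open>m\<close>. With \<open>y = q\<^sup>m\<close> the series is the
  generating function \<open>(1 - y\<^sup>n) / (1 - y)\<^sup>n\<close> of tuples with minimum 0 by sum, which is the product.
\<close>

unbundle fps_syntax

section \<open>Generating functions of tuples\<close>

text \<open>As \<open>card\<close> of an infinite set is 0, the coefficients count \<open>S\<close>
  by weight only when the fibres of \<open>e\<close> are finite.\<close>

definition weight_gf :: "'a set \<Rightarrow> ('a \<Rightarrow> nat) \<Rightarrow> 'b::comm_ring_1 fps" where
  "weight_gf S e = Abs_fps (\<lambda>k. of_nat (card {x \<in> S. e x = k}))"

lemma weight_gf_Un:
  assumes "S \<inter> T = {}" "\<And>k. finite {x \<in> S \<union> T. e x = k}"
  shows "weight_gf (S \<union> T) e = weight_gf S e + weight_gf T e"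
proof (rule fps_ext)
  fix k
  have "{x \<in> S \<union> T. e x = k} = {x \<in> S. e x = k} \<union> {x \<in> T. e x = k}" by auto
  moreover have "finite {x \<in> S. e x = k}" "finite {x \<in> T. e x = k}"
    by (rule finite_subset[OF _ assms(2)[of k]]; auto)+
  ultimately show "weight_gf (S \<union> T) e $ k = (weight_gf S e + weight_gf T e) $ k"
    using assms(1) by (simp add: weight_gf_def) (subst card_Un_disjoint; auto)
qed

text \<open>The bijection matches the fibre over \<open>k - a\<close> with the fibre over
  \<open>k\<close>; for \<open>k < a\<close> both sides are empty.\<close>

lemma weight_gf_bij_betw:
  assumes "bij_betw f S T" "\<And>x. x \<in> S \<Longrightarrow> e' (f x) = e x + a"
  shows "weight_gf T e' = fps_X ^ a * weight_gf S e"
proof (rule fps_ext)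
  fix k
  have "bij_betw f {x \<in> S. e x + a = k} {y \<in> T. e' y = k}"
    using assms by (fastforce simp: bij_betw_def inj_on_def)
  then have "card {y \<in> T. e' y = k} = card {x \<in> S. e x + a = k}"
    by (simp add: bij_betw_same_card)
  moreover have "{x \<in> S. e x + a = k} = (if k < a then {} else {x \<in> S. e x = k - a})"
    by auto
  ultimately show "weight_gf T e' $ k = (fps_X ^ a * weight_gf S e) $ k"
    by (simp add: weight_gf_def fps_X_power_mult_nth)
qed

text \<open>Convergence is coefficientwise: coefficient \<open>k\<close> of a finite partial sum no
  longer changes once the finite set contains the whole fibre of \<open>e\<close> over
  \<open>k\<close>.\<close>

lemma has_sum_weight_gf:
  assumes "\<And>k. finite {x \<in> S. e x = k}"
  shows "((\<lambda>x. fps_X ^ e x :: 'b::comm_ring_1 fps) has_sum weight_gf S e) S"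
  unfolding has_sum_def
proof (rule tendsto_fpsI)
  fix k
  show "\<forall>\<^sub>F F in finite_subsets_at_top S. (\<Sum>x\<in>F. fps_X ^ e x) $ k = (weight_gf S e $ k :: 'b)"
    unfolding eventually_finite_subsets_at_top
  proof (intro exI[of _ "{x \<in> S. e x = k}"] conjI allI impI)
    fix F assume F: "finite F \<and> {x \<in> S. e x = k} \<subseteq> F \<and> F \<subseteq> S"
    then have "F \<inter> {x. e x = k} = {x \<in> S. e x = k}" by auto
    moreover have "(\<Sum>x\<in>F. fps_X ^ e x) $ k = (\<Sum>x\<in>F. if e x = k then 1 else (0::'b))"
      by (simp add: fps_sum_nth eq_commute)
    ultimately show "(\<Sum>x\<in>F. fps_X ^ e x) $ k = (weight_gf S e $ k :: 'b)"
      using F by (simp add: weight_gf_def sum.If_cases)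
  qed (use assms in auto)
qed

text \<open>Solves, without division, the equation that arises when a set splits into a part counted
  by \<open>b\<close> and a copy of itself shifted by the weight in \<open>x\<close>.\<close>

lemma mult_one_minus_eq_if:
  fixes a b x :: "'a::comm_ring_1"
  assumes "a = b + x * a"
  shows "a * (1 - x) = b"
proof -
  have "a * (1 - x) = a - x * a" by (simp add: algebra_simps)
  then show ?thesis using assms by (metis add_diff_cancel_right')
qed

section \<open>Counting tuples and codes by their sum\<close>

text \<open>Fixing the values from \<open>n\<close> on to 0 makes each tuple a single function, so
  that tuples can be compared and counted by equality of functions.\<close>

definition tuples :: "nat \<Rightarrow> (nat \<Rightarrow> nat) set" where
  "tuples n = {c. \<forall>x\<ge>n. c x = 0}"

definition codes :: "nat \<Rightarrow> (nat \<Rightarrow> nat) set" where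
  "codes n = {c \<in> tuples n. \<exists>x<n. c x = 0}"

definition tuple_sum :: "nat \<Rightarrow> (nat \<Rightarrow> nat) \<Rightarrow> nat" where
  "tuple_sum n c = (\<Sum>x<n. c x)"

text \<open>For positive \<open>m\<close> every entry is bounded by the weight, so a fibre lies in a
  finite box.\<close>

lemma finite_tuples_tuple_sum:
  assumes "m > 0"
  shows "finite {c \<in> tuples n. m * tuple_sum n c = k}"
proof (rule finite_subset)
  have "c x \<le> m * tuple_sum n c" if "x < n" for c x
  proof -
    have "c x \<le> tuple_sum n c" unfolding tuple_sum_def using that by (intro member_le_sum) auto
    also have "\<dots> \<le> m * tuple_sum n c" using assms by simp
    finally show ?thesis .
  qed
  then show "{c \<in> tuples n. m * tuple_sum n c = k} \<subseteq>
      {c. \<forall>x. (x \<in> {..<n} \<longrightarrow> c x \<in> {..k}) \<and> (x \<notin> {..<n} \<longrightarrow> c x = 0)}"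
    by (auto simp: tuples_def)
  show "finite {c. \<forall>x. (x \<in> {..<n} \<longrightarrow> c x \<in> {..k}) \<and> (x \<notin> {..<n} \<longrightarrow> c x = (0::nat))}"
    by (rule finite_set_of_finite_funs) auto
qed

lemma tuples_Suc: "tuples (Suc n) = tuples n \<union> {c \<in> tuples (Suc n). c n > 0}"
proof (intro subset_antisym subsetI)
  fix c assume c: "c \<in> tuples (Suc n)"
  show "c \<in> tuples n \<union> {c \<in> tuples (Suc n). c n > 0}"
  proof (cases "c n = 0")
    case True
    have "c x = 0" if "n \<le> x" for x
      using that c True by (cases "x = n") (auto simp: tuples_def)
    then show ?thesis by (simp add: tuples_def)
  qed (use c in simp)
qed (auto simp: tuples_def)

lemma bij_betw_tuples_Suc:
  "bij_betw (\<lambda>c. c(n := Suc (c n))) (tuples (Suc n)) {c \<in> tuples (Suc n). c n > 0}"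
  by (rule bij_betwI[where g = "\<lambda>c. c(n := c n - 1)"]) (auto simp: tuples_def)

text \<open>Lowering a positive last entry by one gives back an arbitrary tuple of the same size, so
  each further entry contributes a factor \<open>1 / (1 - fps_X ^ m)\<close>.\<close>

lemma weight_gf_tuples:
  assumes "m > 0"
  shows "weight_gf (tuples n) (\<lambda>c. m * tuple_sum n c) * (1 - fps_X ^ m) ^ n = (1 :: 'b::comm_ring_1 fps)"
proof (induction n)
  case 0
  have "tuples 0 = {\<lambda>_. 0}" by (auto simp: tuples_def)
  then have "{x \<in> tuples 0. m * tuple_sum 0 x = k} = (if k = 0 then {\<lambda>_. 0} else {})" for k
    by (auto simp: tuple_sum_def)
  then show ?case by (intro fps_ext) (simp add: weight_gf_def)
next
  case (Suc n)
  let ?e = "\<lambda>n c. m * tuple_sum n c" and ?P = "{c \<in> tuples (Suc n). c n > 0}"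
  have fin: "finite {c \<in> tuples n \<union> ?P. ?e (Suc n) c = k}" for k
    using finite_tuples_tuple_sum[OF assms, of "Suc n" k] by (simp only: tuples_Suc[symmetric])
  have "weight_gf (tuples n \<union> ?P) (?e (Suc n)) =
      weight_gf (tuples n) (?e (Suc n)) + (weight_gf ?P (?e (Suc n)) :: 'b fps)"
    by (rule weight_gf_Un[OF _ fin]) (auto simp: tuples_def)
  \<comment> \<open>On \<open>tuples n\<close> the entry at \<open>n\<close> is 0, so both sums
    agree.\<close>
  also have "weight_gf (tuples n) (?e (Suc n)) = fps_X ^ 0 * (weight_gf (tuples n) (?e n) :: 'b fps)"
    by (rule weight_gf_bij_betw[of id]) (auto simp: tuple_sum_def tuples_def)
  also have "weight_gf ?P (?e (Suc n)) = fps_X ^ m * (weight_gf (tuples (Suc n)) (?e (Suc n)) :: 'b fps)"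
  proof (rule weight_gf_bij_betw[OF bij_betw_tuples_Suc])
    fix c
    have "tuple_sum (Suc n) (c(n := Suc (c n))) = tuple_sum (Suc n) c + 1"
      by (simp add: tuple_sum_def)
    then show "?e (Suc n) (c(n := Suc (c n))) = ?e (Suc n) c + m"
      by (simp add: add_mult_distrib2)
  qed
  finally have "weight_gf (tuples (Suc n)) (?e (Suc n)) =
      weight_gf (tuples n) (?e n) + fps_X ^ m * (weight_gf (tuples (Suc n)) (?e (Suc n)) :: 'b fps)"
    unfolding tuples_Suc[symmetric] power_0 mult_1 .
  then have "weight_gf (tuples (Suc n)) (?e (Suc n)) * (1 - fps_X ^ m) =
      (weight_gf (tuples n) (?e n) :: 'b fps)"
    by (rule mult_one_minus_eq_if)
  then show ?case using Suc.IH by (simp only: power_Suc mult.assoc[symmetric])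
qed

text \<open>The tuples that are not codes have all entries positive; lowering all \<open>n\<close>
  entries by one maps them onto all tuples and lowers the weight by \<open>m * n\<close>.\<close>

lemma weight_gf_codes:
  assumes "m > 0"
  shows "weight_gf (codes n) (\<lambda>c. m * tuple_sum n c) =
    weight_gf (tuples n) (\<lambda>c. m * tuple_sum n c) * (1 - fps_X ^ (m * n) :: 'b::comm_ring_1 fps)"
proof -
  let ?e = "\<lambda>c. m * tuple_sum n c" and ?P = "{c \<in> tuples n. \<forall>x<n. c x > 0}"
  have split: "tuples n = codes n \<union> ?P"
    by (auto simp: codes_def)
  have bij: "bij_betw (\<lambda>c x. if x < n then Suc (c x) else c x) (tuples n) ?P"
    by (rule bij_betwI[where g = "\<lambda>c x. if x < n then c x - 1 else c x"]) (auto simp: tuples_def)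
  have fin: "finite {c \<in> codes n \<union> ?P. ?e c = k}" for k
    using finite_tuples_tuple_sum[OF assms, of n k] by (simp only: split[symmetric])
  have "weight_gf (codes n \<union> ?P) ?e = weight_gf (codes n) ?e + (weight_gf ?P ?e :: 'b fps)"
    by (rule weight_gf_Un[OF _ fin]) (auto simp: codes_def)
  also have "weight_gf ?P ?e = fps_X ^ (m * n) * (weight_gf (tuples n) ?e :: 'b fps)"
  proof (rule weight_gf_bij_betw[OF bij])
    fix c
    have "tuple_sum n (\<lambda>x. if x < n then Suc (c x) else c x) = (\<Sum>x<n. c x + 1)"
      unfolding tuple_sum_def by (rule sum.cong) auto
    then show "?e (\<lambda>x. if x < n then Suc (c x) else c x) = ?e c + m * n"
      by (simp only: sum.distrib) (simp add: tuple_sum_def algebra_simps)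
  qed
  finally have "weight_gf (tuples n) ?e =
      weight_gf (codes n) ?e + fps_X ^ (m * n) * (weight_gf (tuples n) ?e :: 'b fps)"
    unfolding split[symmetric] .
  from mult_one_minus_eq_if[OF this] show ?thesis ..
qed

section \<open>The product formula\<close>

lemma q_int_mult: "q_int k q * (1 - q) = 1 - (q :: 'a::comm_ring_1) ^ k"
  unfolding q_int_def by (metis mult.commute one_diff_power_eq)

text \<open>The product telescopes: with \<open>Y = fps_X ^ m\<close>, passing from \<open>n\<close>
  to \<open>Suc n\<close> divides by \<open>1 - Y ^ n\<close> and multiplies by
  \<open>q_int (Suc n) Y * (1 - Y) = 1 - Y ^ Suc n\<close>.\<close>

lemma bott_product:
  assumes "m > 0" "n > 0"
  shows "(\<Prod>k=1..n. q_int k (fps_X ^ m)) * (\<Prod>k=2..n. 1 / (1 - fps_X ^ ((k - 1) * m))) *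
    (1 - fps_X ^ m) ^ n = (1 - fps_X ^ (m * n) :: 'b::field fps)"
  using \<open>n > 0\<close>
proof (induction n rule: nat_induct_non_zero)
  case 1
  then show ?case by (simp add: q_int_def)
next
  case (Suc n)
  define Y where "Y = (fps_X ^ m :: 'b fps)"
  define P where "P = (\<Prod>k=1..n. q_int k Y)"
  define Q where "Q = (\<Prod>k=2..n. 1 / (1 - fps_X ^ ((k - 1) * m)) :: 'b fps)"
  \<comment> \<open>A nonzero constant coefficient makes the series invertible, so the quotient is a
    true inverse.\<close>
  have "(1 - Y ^ n) $ 0 \<noteq> 0"
    using Suc assms by (simp add: Y_def power_0_left flip: power_mult)
  then have unit: "(1 - Y ^ n) * (1 / (1 - Y ^ n)) = 1"
    by (simp add: fps_divide_unit inverse_mult_eq_1')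
  have Q: "(\<Prod>k=2..Suc n. 1 / (1 - fps_X ^ ((k - 1) * m))) = Q * (1 / (1 - Y ^ n))"
    using Suc by (subst prod.cl_ivl_Suc) (auto simp: Q_def Y_def power_mult mult.commute)
  have IH: "P * Q * (1 - Y) ^ n = 1 - Y ^ n"
    using Suc.IH by (simp add: P_def Q_def Y_def power_mult)
  have "(\<Prod>k=1..Suc n. q_int k Y) * (Q * (1 / (1 - Y ^ n))) * (1 - Y) ^ Suc n =
      P * Q * (1 - Y) ^ n * (1 / (1 - Y ^ n)) * (q_int (Suc n) Y * (1 - Y))"
    by (simp add: P_def mult_ac)
  also have "\<dots> = 1 - Y ^ Suc n"
    by (simp only: IH unit q_int_mult mult_1)
  moreover have "fps_X ^ (m * Suc n) = Y ^ Suc n"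
    by (simp only: Y_def power_mult)
  ultimately show ?case
    unfolding Q Y_def[symmetric] by simp
qed

text \<open>Both sides become \<open>1 - fps_X ^ (m * n)\<close> after multiplication by the nonzero
  series \<open>(1 - fps_X ^ m) ^ n\<close>, which can be cancelled.\<close>

lemma weight_gf_codes_bott:
  assumes "m > 0" "n > 0"
  shows "weight_gf (codes n) (\<lambda>c. m * tuple_sum n c) =
    (\<Prod>k=1..n. q_int k (fps_X ^ m)) * (\<Prod>k=2..n. 1 / (1 - fps_X ^ ((k - 1) * m)) :: 'b::field fps)"
proof -
  let ?D = "(1 - fps_X ^ m) ^ n :: 'b fps"
  have "weight_gf (codes n) (\<lambda>c. m * tuple_sum n c) * ?D = (1 - fps_X ^ (m * n) :: 'b fps)"
    unfolding weight_gf_codes[OF assms(1)]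
    using weight_gf_tuples[OF assms(1), of n, where 'b='b] by (metis mult.commute mult.assoc mult_1)
  moreover have "?D $ 0 = 1" using assms by (simp add: fps_power_zeroth power_0_left)
  then have "?D \<noteq> 0" by (metis fps_zero_nth zero_neq_one)
  ultimately show ?thesis using bott_product[OF assms, where 'b='b] by (metis mult_right_cancel)
qed

section \<open>The action on codes\<close>

text \<open>Inversion counts per position change like this when two neighbouring values are
  exchanged: the counts trade places, and the count of the larger value changes by one.\<close>

definition move :: "'a \<Rightarrow> 'a \<Rightarrow> ('a \<Rightarrow> nat) \<Rightarrow> 'a \<Rightarrow> nat" where
  "move i j c = (if c i \<le> c j then c(i := Suc (c j), j := c i) else c(i := c j, j := c i - 1))"

lemma move_apply:
  assumes "i \<noteq> j"
  shows "move i j c i = (if c i \<le> c j then Suc (c j) else c j)"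
    and "move i j c j = (if c i \<le> c j then c i else c i - 1)"
  using assms by (auto simp: move_def)

lemma move_other: "x \<noteq> i \<Longrightarrow> x \<noteq> j \<Longrightarrow> move i j c x = c x"
  by (simp add: move_def)

lemma move_move:
  assumes "i \<noteq> j"
  shows "move i j (move i j c) = c"
proof
  fix x
  consider "x = i" | "x = j" | "x \<notin> {i, j}" by blast
  then show "move i j (move i j c) x = c x"
    by cases (use assms in \<open>auto simp: move_apply move_other\<close>)
qed

lemma move_commute:
  assumes "i \<noteq> j" "k \<noteq> l" "{i, j} \<inter> {k, l} = {}"
  shows "move i j (move k l c) = move k l (move i j c)"
proof
  fix x
  have neq: "i \<noteq> k" "i \<noteq> l" "j \<noteq> k" "j \<noteq> l" using assms(3) by auto
  consider "x = i" | "x = j" | "x = k" | "x = l" | "x \<notin> {i, j, k, l}" by blast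
  then show "move i j (move k l c) x = move k l (move i j c) x"
    by cases (use assms(1,2) neq in \<open>simp_all add: move_apply move_other\<close>)
qed

text \<open>An entrywise check by cases on the comparisons among the three entries; for example,
  both sides send \<open>(a, b, c)\<close> with \<open>a <= b <= c\<close> to
  \<open>(c + 2, b + 1, a)\<close>.\<close>

lemma move_braid:
  assumes "distinct [i, j, k]"
  shows "move i j (move j k (move i j c)) = move j k (move i j (move j k c))"
proof
  fix x
  have neq: "i \<noteq> j" "i \<noteq> k" "j \<noteq> k" using assms by auto
  consider "x = i" | "x = j" | "x = k" | "x \<notin> {i, j, k}" by blast
  then show "move i j (move j k (move i j c)) x = move j k (move i j (move j k c)) x"
    by cases (use neq in \<open>auto simp: move_apply move_other\<close>)
qed

text \<open>The truncated subtraction is harmless: in that case \<open>c i\<close> is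
  positive.\<close>

lemma sum_move:
  assumes "finite A" "i \<in> A" "j \<in> A" "i \<noteq> j"
  shows "sum (move i j c) A = (if c i \<le> c j then Suc (sum c A) else sum c A - 1)"
proof -
  have split: "sum d A = d i + d j + sum d (A - {i, j})" for d :: "'a \<Rightarrow> nat"
  proof -
    have "sum d A = sum d {i, j} + sum d (A - {i, j})"
      using assms by (metis add.commute empty_subsetI insert_subset sum.subset_diff)
    then show ?thesis using assms(4) by simp
  qed
  have "sum (move i j c) (A - {i, j}) = sum c (A - {i, j})"
    by (rule sum.cong) (auto simp: move_def)
  moreover have "move i j c i + move i j c j =
      (if c i \<le> c j then Suc (c i + c j) else c i + c j - 1)"
    using assms(4) by (auto simp: move_def)
  ultimately show ?thesis
    using split[of c] split[of "move i j c"] by (cases "c i \<le> c j") simp_all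
qed

section \<open>The cyclic action and its descents\<close>

definition act :: "nat \<Rightarrow> nat \<Rightarrow> (nat \<Rightarrow> nat) \<Rightarrow> nat \<Rightarrow> nat" where
  "act N i = move i (Suc i mod N)"

definition descent :: "nat \<Rightarrow> nat \<Rightarrow> (nat \<Rightarrow> nat) \<Rightarrow> bool" where
  "descent N i c \<longleftrightarrow> c i > c (Suc i mod N)"

abbreviation act_list :: "nat \<Rightarrow> nat list \<Rightarrow> (nat \<Rightarrow> nat) \<Rightarrow> nat \<Rightarrow> nat" where
  "act_list N \<equiv> foldr (act N)"

lemma Suc_mod_neq: "2 \<le> N \<Longrightarrow> i < N \<Longrightarrow> Suc i mod N \<noteq> i"
  by (cases "Suc i = N") auto

lemma Suc_mod_inj: "i < N \<Longrightarrow> j < N \<Longrightarrow> Suc i mod N = Suc j mod N \<Longrightarrow> i = j"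
  by (cases "Suc i = N"; cases "Suc j = N") auto

lemma Suc_Suc_mod_neq: "3 \<le> N \<Longrightarrow> i < N \<Longrightarrow> Suc (Suc i mod N) mod N \<noteq> i"
  by (cases "Suc i = N"; cases "Suc (Suc i) = N") auto

lemma act_act: "2 \<le> N \<Longrightarrow> i < N \<Longrightarrow> act N i (act N i c) = c"
  by (metis act_def move_move Suc_mod_neq)

lemma act_commute:
  assumes "i < N" "j < N" "i \<noteq> j" "j \<noteq> Suc i mod N" "i \<noteq> Suc j mod N"
  shows "act N i (act N j c) = act N j (act N i c)"
  unfolding act_def
  using assms Suc_mod_inj[of i N j] Suc_mod_neq[of N i] Suc_mod_neq[of N j]
  by (intro move_commute) auto

lemma act_braid:
  assumes "3 \<le> N" "i < N" "j = Suc i mod N"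
  shows "act N i (act N j (act N i c)) = act N j (act N i (act N j c))"
  unfolding act_def assms(3)
  using assms Suc_mod_neq[of N i] Suc_mod_neq[of N "Suc i mod N"] Suc_Suc_mod_neq[of N i]
  by (intro move_braid) auto

lemma tuple_sum_act:
  assumes "2 \<le> N" "i < N"
  shows "tuple_sum N (act N i c) = (if descent N i c then tuple_sum N c - 1 else Suc (tuple_sum N c))"
  using assms Suc_mod_neq[OF assms] by (simp add: tuple_sum_def act_def sum_move descent_def)

lemma tuple_sum_pos_if_descent: "i < N \<Longrightarrow> descent N i c \<Longrightarrow> tuple_sum N c > 0"
  by (auto simp: descent_def tuple_sum_def intro!: sum_pos2[of _ i])

lemma descent_act_iff:
  "2 \<le> N \<Longrightarrow> i < N \<Longrightarrow> descent N i (act N i c) \<longleftrightarrow> \<not> descent N i c"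
  using Suc_mod_neq[of N i] by (auto simp: descent_def act_def move_def)

lemma tuple_sum_act_list_le:
  assumes "2 \<le> N" "xs \<in> lists {..<N}"
  shows "tuple_sum N (act_list N xs (\<lambda>_. 0)) \<le> length xs"
  using assms(2)
proof (induction xs)
  case (Cons i xs)
  then show ?case using assms(1) tuple_sum_act[of N i "act_list N xs (\<lambda>_. 0)"] by auto
qed (simp add: tuple_sum_def)

lemma act_in_codes:
  assumes "2 \<le> N" "i < N" "c \<in> codes N"
  shows "act N i c \<in> codes N"
proof -
  let ?j = "Suc i mod N"
  obtain x where x: "x < N" "c x = 0" using assms(3) by (auto simp: codes_def)
  have j: "?j < N" "?j \<noteq> i" using assms Suc_mod_neq by auto
  \<comment> \<open>A zero away from both positions stays. Otherwise the smaller of the two entries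
    is 0: if \<open>c i <= c ?j\<close> it is \<open>c i\<close>, which moves to \<open>?j\<close>;
    if not, it is \<open>c ?j\<close>, which moves to \<open>i\<close>.\<close>
  define y where "y = (if x \<noteq> i \<and> x \<noteq> ?j then x else if c i \<le> c ?j then ?j else i)"
  have "act N i c y = 0"
    using x j unfolding act_def move_def y_def by auto
  moreover have "y < N" using x(1) j(1) assms(2) by (simp add: y_def)
  moreover have "act N i c \<in> tuples N"
    using assms(2,3) j(1) by (auto simp: codes_def tuples_def act_def move_def simp del: mod_less_divisor)
  ultimately show ?thesis unfolding codes_def by blast
qed

text \<open>Without a descent the entries increase weakly around the whole cycle; going backwards
  from a zero entry then forces every entry to be 0.\<close>

lemma ex_descent:
  assumes "c \<in> codes N" "c \<noteq> (\<lambda>_. 0)"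
  shows "\<exists>i<N. descent N i c"
proof (rule ccontr)
  assume "\<not> ?thesis"
  then have le: "c i \<le> c (Suc i mod N)" if "i < N" for i
    using that by (meson descent_def not_less)
  obtain x where x: "x < N" "c x = 0" using assms(1) by (auto simp: codes_def)
  \<comment> \<open>The position reached from \<open>x\<close> by \<open>k\<close> steps backwards;
    the summand \<open>N\<close> keeps the subtraction exact.\<close>
  have "c ((x + N - k) mod N) = 0" if "k \<le> N" for k
    using that
  proof (induction k)
    case (Suc k)
    define y where "y = (x + N - Suc k) mod N"
    have "Suc (x + N - Suc k) = x + N - k" using Suc.prems by simp
    then have "Suc y mod N = (x + N - k) mod N" unfolding y_def by (metis mod_Suc_eq)
    moreover have "c ((x + N - k) mod N) = 0" using Suc by simp
    moreover have "y < N" unfolding y_def using x(1) by simp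
    ultimately have "c y \<le> 0" using le[of y] by simp
    then show ?case by (simp add: y_def)
  qed (use x in simp)
  note zero = this
  have "c y = 0" if "y < N" for y
  proof (cases "y \<le> x")
    case True
    then show ?thesis using zero[of "x - y"] x(1) that by (simp add: le_diff_conv)
  next
    case False
    then show ?thesis using zero[of "x + N - y"] x(1) that by simp
  qed
  moreover have "c y = 0" if "N \<le> y" for y using that assms(1) by (simp add: codes_def tuples_def)
  ultimately show False using assms(2) by (metis ext linorder_not_less)
qed

section \<open>Reduced words for codes\<close>

text \<open>Every letter changes the sum by one, so this says that each letter raises it, the last
  letter acting first. That such words have minimal length is shown in
  \<open>affine_A_length_reduced\<close>.\<close>

definition reduced :: "nat \<Rightarrow> nat list \<Rightarrow> bool" where
  "reduced N xs \<longleftrightarrow> xs \<in> lists {..<N} \<and> tuple_sum N (act_list N xs (\<lambda>_. 0)) = length xs"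

text \<open>The sum reached by \<open>xs\<close> is at most \<open>length xs\<close>, so
  \<open>i # xs\<close> can attain its length only if \<open>xs\<close> already does and
  \<open>i\<close> raises the sum.\<close>

lemma reduced_Cons_iff:
  assumes "2 \<le> N" "i < N"
  shows "reduced N (i # xs) \<longleftrightarrow> reduced N xs \<and> \<not> descent N i (act_list N xs (\<lambda>_. 0))"
proof (cases "xs \<in> lists {..<N}")
  case True
  then show ?thesis
    using assms tuple_sum_act[OF assms, of "act_list N xs (\<lambda>_. 0)"]
      tuple_sum_act_list_le[OF assms(1) True]
    by (auto simp: reduced_def)
qed (auto simp: reduced_def)

lemma reduced_Cons_descent:
  assumes "2 \<le> N" "i < N" "descent N i c" "reduced N xs" "act_list N xs (\<lambda>_. 0) = act N i c"
  shows "reduced N (i # xs)" "act_list N (i # xs) (\<lambda>_. 0) = c"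
  using assms by (simp_all add: reduced_Cons_iff descent_act_iff act_act)

text \<open>Undoing a descent lowers the sum, so induction on the sum leads down to the zero
  code.\<close>

lemma ex_reduced:
  assumes "2 \<le> N" "c \<in> codes N"
  shows "\<exists>xs. reduced N xs \<and> act_list N xs (\<lambda>_. 0) = c"
  using assms(2)
proof (induction "tuple_sum N c" arbitrary: c rule: less_induct)
  case less
  show ?case
  proof (cases "c = (\<lambda>_. 0)")
    case True
    then show ?thesis by (auto simp: reduced_def tuple_sum_def intro!: exI[of _ "[]"])
  next
    case False
    then obtain i where i: "i < N" "descent N i c" using ex_descent less.prems by blast
    then have "tuple_sum N (act N i c) < tuple_sum N c"
      using tuple_sum_act[OF assms(1) i(1), of c] tuple_sum_pos_if_descent[OF i] by simp
    then show ?thesis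
      using less.hyps[of "act N i c"] act_in_codes[OF assms(1) i(1) less.prems]
        reduced_Cons_descent[OF assms(1) i] by blast
  qed
qed

lemma act_list_in_codes:
  assumes "2 \<le> N" "xs \<in> lists {..<N}"
  shows "act_list N xs (\<lambda>_. 0) \<in> codes N"
  using assms(2)
proof (induction xs)
  case Nil
  then show ?case using assms(1) by (auto simp: codes_def tuples_def intro!: exI[of _ 0])
next
  case (Cons i xs)
  then show ?case using act_in_codes[OF assms(1)] by simp
qed

section \<open>Normal forms in the presented group\<close>

abbreviation affine_rel :: "nat \<Rightarrow> (nat word \<times> nat word) set" where
  "affine_rel N \<equiv> word_rel {..<N} (affine_A_relators N)"

definition pos_word :: "'a list \<Rightarrow> 'a word" where
  "pos_word xs = map (\<lambda>i. (i, True)) xs"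

text \<open>Words without formal inverses suffice for normal forms, since the generators are
  involutions.\<close>

definition word_eq :: "nat \<Rightarrow> nat list \<Rightarrow> nat list \<Rightarrow> bool" where
  "word_eq N xs ys \<longleftrightarrow> (pos_word xs, pos_word ys) \<in> affine_rel N"

lemma pos_word_simps [simp]:
  "pos_word [] = []" "pos_word (i # xs) = (i, True) # pos_word xs"
  "pos_word (xs @ ys) = pos_word xs @ pos_word ys" "map fst (pos_word xs) = xs"
  by (simp_all add: pos_word_def comp_def)

lemma pos_word_in_words_iff [simp]: "pos_word xs \<in> words S \<longleftrightarrow> xs \<in> lists S"
  by (induction xs) auto

lemma affine_A_relators_cases:
  assumes "r \<in> affine_A_relators N"
  obtains (square) i where "r = pos_word [i, i]" "i < N"
  | (braid) i j where "r = pos_word [i, j, i, j, i, j]" "3 \<le> N" "i < N" "j = Suc i mod N"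
  | (commute) i j where "r = pos_word [i, j, i, j]" "3 \<le> N" "i < N" "j < N"
      "j \<noteq> i" "j \<noteq> Suc i mod N" "i \<noteq> Suc j mod N"
  using assms unfolding affine_A_relators_def pos_word_def[symmetric] by (auto simp: image_iff)

lemma act_list_relator:
  assumes "2 \<le> N" "r \<in> affine_A_relators N"
  shows "act_list N (map fst r) c = c"
  using assms(2)
proof (cases rule: affine_A_relators_cases)
  case (square i)
  then show ?thesis using assms(1) by (simp add: act_act)
next
  case (braid i j)
  then have "j < N" by simp
  have "act_list N (map fst r) c = act N i (act N j (act N i (act N j (act N i (act N j c)))))"
    by (simp add: braid(1))
  \<comment> \<open>The braid relation is applied to the three outer letters; what remains collapses
    by \<open>act_act\<close>.\<close>
  also have "\<dots> = act N j (act N i (act N j (act N j (act N i (act N j c)))))"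
    by (rule act_braid[OF braid(2-4)])
  finally show ?thesis using assms(1) braid(3) \<open>j < N\<close> by (simp add: act_act)
next
  case (commute i j)
  then show ?thesis using assms(1) by (simp add: act_commute[of i N j] act_act)
qed

text \<open>This makes the action well defined on the group. Forgetting the signs with
  \<open>map fst\<close> is legitimate because each letter acts as an involution.\<close>

lemma act_list_word_rel:
  assumes "2 \<le> N" "(u, v) \<in> affine_rel N"
  shows "act_list N (map fst u) = act_list N (map fst v)"
  using assms(2)
proof (induction rule: word_rel.induct)
  case (cancel u v s b)
  then show ?case using assms(1) by (simp add: fun_eq_iff act_act)
next
  case (relator u v r)
  then show ?case using act_list_relator[OF assms(1), of r] by (intro ext) simp
qed auto

lemma act_list_word_eq: "2 \<le> N \<Longrightarrow> word_eq N xs ys \<Longrightarrow> act_list N xs = act_list N ys"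
  unfolding word_eq_def by (drule (1) act_list_word_rel) simp

lemma word_eq_refl: "xs \<in> lists {..<N} \<Longrightarrow> word_eq N xs xs"
  by (simp add: word_eq_def word_rel.refl)

lemma word_eq_sym: "word_eq N xs ys \<Longrightarrow> word_eq N ys xs"
  by (auto simp: word_eq_def intro: word_rel.sym)

lemma word_eq_trans [trans]: "word_eq N xs ys \<Longrightarrow> word_eq N ys zs \<Longrightarrow> word_eq N xs zs"
  by (auto simp: word_eq_def intro: word_rel.trans)

lemma word_eq_append: "word_eq N xs xs' \<Longrightarrow> word_eq N ys ys' \<Longrightarrow> word_eq N (xs @ ys) (xs' @ ys')"
  by (auto simp: word_eq_def intro: word_rel_append)

lemma word_eq_Cons: "i < N \<Longrightarrow> word_eq N xs ys \<Longrightarrow> word_eq N (i # xs) (i # ys)"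
  using word_eq_append[of N "[i]" "[i]" xs ys] by (simp add: word_eq_refl)

lemma word_eq_relator:
  assumes "pos_word xs \<in> affine_A_relators N" "xs \<in> lists {..<N}"
  shows "word_eq N xs []"
  using word_rel.relator[of "[]" "{..<N}" "[]" "pos_word xs" "affine_A_relators N"] assms
  by (simp add: word_eq_def)

lemma word_eq_square:
  assumes "i < N"
  shows "word_eq N [i, i] []"
proof (rule word_eq_relator)
  show "pos_word [i, i] \<in> affine_A_relators N"
    unfolding affine_A_relators_def pos_word_def[symmetric] using assms by blast
qed (use assms in simp)

lemma word_eq_append_rev: "xs \<in> lists {..<N} \<Longrightarrow> word_eq N (xs @ rev xs) []"
proof (induction xs)
  case (Cons i xs)
  have "word_eq N ([i] @ (xs @ rev xs) @ [i]) ([i] @ [] @ [i])"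
    using Cons by (intro word_eq_append word_eq_refl) auto
  moreover have "word_eq N [i, i] []" using Cons by (intro word_eq_square) auto
  ultimately show ?case by (auto intro: word_eq_trans)
qed (simp add: word_eq_refl)

text \<open>As the reverse of a word is its inverse, this turns a relator, cut in the middle, into
  an equation between its halves: a commutation or a braid relation.\<close>

lemma word_eq_rev_if_append_trivial:
  assumes "word_eq N (xs @ ys) []" "xs \<in> lists {..<N}" "ys \<in> lists {..<N}"
  shows "word_eq N xs (rev ys)"
proof -
  have "word_eq N (xs @ []) (xs @ (ys @ rev ys))"
    using assms(2,3) by (intro word_eq_append word_eq_refl word_eq_sym[OF word_eq_append_rev])
  also have "xs @ (ys @ rev ys) = (xs @ ys) @ rev ys" by simp
  also have "word_eq N \<dots> ([] @ rev ys)"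
    using assms by (intro word_eq_append word_eq_refl) auto
  finally show ?thesis by simp
qed

lemma word_eq_commute:
  assumes "3 \<le> N" "i < N" "j < N" "j \<noteq> i" "j \<noteq> Suc i mod N" "i \<noteq> Suc j mod N"
  shows "word_eq N [i, j] [j, i]"
proof -
  have "pos_word [i, j, i, j] \<in> affine_A_relators N"
    unfolding affine_A_relators_def pos_word_def[symmetric] using assms by (intro imageI) auto
  then have "word_eq N ([i, j] @ [i, j]) []"
    using word_eq_relator assms by simp
  from word_eq_rev_if_append_trivial[OF this] show ?thesis using assms by simp
qed

lemma word_eq_braid:
  assumes "3 \<le> N" "i < N" "j = Suc i mod N"
  shows "word_eq N [i, j, i] [j, i, j]"
proof -
  have "j < N" using assms by simp
  have "pos_word [i, j, i, j, i, j] \<in> affine_A_relators N"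
    unfolding affine_A_relators_def pos_word_def[symmetric] using assms by (intro imageI) auto
  then have "word_eq N ([i, j, i] @ [j, i, j]) []"
    using word_eq_relator[of "[i, j, i, j, i, j]" N] assms(2) \<open>j < N\<close> by simp
  from word_eq_rev_if_append_trivial[OF this] show ?thesis using assms(2) \<open>j < N\<close> by simp
qed

section \<open>Local confluence and uniqueness of reduced words\<close>

text \<open>The three entries are strictly decreasing, which excludes \<open>N = 2\<close>, where
  the third position would be the first again. Both ways around the braid hexagon then go down at
  every step.\<close>

lemma descents_adjacent:
  assumes "2 \<le> N" "i < N" "j = Suc i mod N" "descent N i c" "descent N j c"
  shows "3 \<le> N" "descent N j (act N i c)" "descent N i (act N j (act N i c))"
    "descent N i (act N j c)" "descent N j (act N i (act N j c))"
proof -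
  define k where "k = Suc j mod N"
  have gt: "c i > c j" "c j > c k"
    using assms unfolding descent_def k_def by auto
  then have "i \<noteq> k" by auto
  show "3 \<le> N"
  proof (rule ccontr)
    assume "\<not> 3 \<le> N"
    then have "N = 2" using assms(1) by simp
    then have "i = 0 \<or> i = 1" using assms(2) by auto
    then show False using \<open>i \<noteq> k\<close> \<open>N = 2\<close> by (auto simp: k_def assms(3))
  qed
  have neq: "i \<noteq> j" "j \<noteq> k" "i \<noteq> k"
    using gt by auto
  have a: "act N i = move i j" "act N j = move j k"
    by (simp_all add: act_def assms(3) k_def)
  have d: "descent N i e \<longleftrightarrow> e i > e j" "descent N j e \<longleftrightarrow> e j > e k" for e
    by (simp_all add: descent_def assms(3) k_def)
  show "descent N j (act N i c)" "descent N i (act N j (act N i c))"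
    "descent N i (act N j c)" "descent N j (act N i (act N j c))"
    unfolding a d using gt neq by (auto simp: move_apply move_other)
qed

lemma descent_act_nonadjacent:
  assumes "i < N" "j < N" "j \<noteq> i" "j \<noteq> Suc i mod N" "i \<noteq> Suc j mod N" "descent N j c"
  shows "descent N j (act N i c)"
proof -
  have "Suc j mod N \<noteq> i" "Suc j mod N \<noteq> Suc i mod N"
    using assms(5) Suc_mod_inj[of i N j] assms(1-3) by auto
  then show ?thesis using assms(3,4,6) by (simp add: descent_def act_def move_other)
qed

text \<open>Both descending paths of the hexagon meet in one code. A reduced word \<open>zs\<close>
  for it extends upwards along either path, and the two extensions differ by a braid
  relation.\<close>

lemma descents_confluent_adjacent:
  assumes N: "2 \<le> N" and ij: "i < N" "j = Suc i mod N"
    and d: "descent N i c" "descent N j c" and c: "c \<in> codes N"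
  shows "\<exists>us vs. reduced N us \<and> act_list N us (\<lambda>_. 0) = act N i c \<and>
    reduced N vs \<and> act_list N vs (\<lambda>_. 0) = act N j c \<and> word_eq N (i # us) (j # vs)"
proof -
  note desc = descents_adjacent[OF N ij d]
  have j: "j < N" using ij by simp
  have eq: "act N j (act N i (act N j c)) = act N i (act N j (act N i c))"
    using act_braid[OF desc(1) ij] by simp
  obtain zs where zs: "reduced N zs" "act_list N zs (\<lambda>_. 0) = act N i (act N j (act N i c))"
    using ex_reduced[OF N] act_in_codes[OF N] c ij(1) j by meson
  \<comment> \<open>Climbing back one step at a time: each prepended letter undoes one of the
    descents in \<open>desc\<close>.\<close>
  have izs: "reduced N (i # zs)" "act_list N (i # zs) (\<lambda>_. 0) = act N j (act N i c)"
    using reduced_Cons_descent[OF N ij(1) desc(3) zs] by auto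
  have jzs: "reduced N (j # zs)" "act_list N (j # zs) (\<lambda>_. 0) = act N i (act N j c)"
    using reduced_Cons_descent[OF N j desc(5) zs(1) zs(2)[folded eq]] by auto
  have jizs: "reduced N (j # i # zs)" "act_list N (j # i # zs) (\<lambda>_. 0) = act N i c"
    using reduced_Cons_descent[OF N j desc(2) izs] by auto
  have ijzs: "reduced N (i # j # zs)" "act_list N (i # j # zs) (\<lambda>_. 0) = act N j c"
    using reduced_Cons_descent[OF N ij(1) desc(4) jzs] by auto
  have "word_eq N ([i, j, i] @ zs) ([j, i, j] @ zs)"
    using zs(1) desc(1) ij by (intro word_eq_append word_eq_braid word_eq_refl) (auto simp: reduced_def)
  then have "word_eq N (i # j # i # zs) (j # i # j # zs)" by simp
  then show ?thesis using jizs ijzs by blast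
qed

lemma descents_confluent:
  assumes N: "2 \<le> N" and ij: "i < N" "j < N" "i \<noteq> j"
    and d: "descent N i c" "descent N j c" and c: "c \<in> codes N"
  shows "\<exists>us vs. reduced N us \<and> act_list N us (\<lambda>_. 0) = act N i c \<and>
    reduced N vs \<and> act_list N vs (\<lambda>_. 0) = act N j c \<and> word_eq N (i # us) (j # vs)"
proof -
  consider "j = Suc i mod N" | "i = Suc j mod N" | "j \<noteq> Suc i mod N" "i \<noteq> Suc j mod N"
    by blast
  then show ?thesis
  proof cases
    case 1
    then show ?thesis using descents_confluent_adjacent N ij d c by blast
  next
    case 2
    obtain us vs where "reduced N us" "act_list N us (\<lambda>_. 0) = act N j c"
        "reduced N vs" "act_list N vs (\<lambda>_. 0) = act N i c" "word_eq N (j # us) (i # vs)"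
      using descents_confluent_adjacent[OF N ij(2) 2 d(2,1) c] by blast
    then show ?thesis using word_eq_sym by blast
  next
    case 3
    \<comment> \<open>With two generators, distinct indices are adjacent, so this case cannot occur
      for \<open>N = 2\<close>.\<close>
    have "3 \<le> N"
    proof (rule ccontr)
      assume "\<not> 3 \<le> N"
      then have "N = 2" using N by simp
      then have "i = 0 \<and> j = 1 \<or> i = 1 \<and> j = 0" using ij by auto
      then show False using 3 \<open>N = 2\<close> by auto
    qed
    have eq: "act N i (act N j c) = act N j (act N i c)"
      using act_commute ij 3 by blast
    obtain zs where zs: "reduced N zs" "act_list N zs (\<lambda>_. 0) = act N j (act N i c)"
      using ex_reduced[OF N] act_in_codes[OF N] c ij by meson
    have desc: "descent N j (act N i c)" "descent N i (act N j c)"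
      using descent_act_nonadjacent ij 3 d by simp_all
    have "reduced N (j # zs)" "act_list N (j # zs) (\<lambda>_. 0) = act N i c"
      using reduced_Cons_descent[OF N ij(2) desc(1) zs] by auto
    moreover have "reduced N (i # zs)" "act_list N (i # zs) (\<lambda>_. 0) = act N j c"
      using reduced_Cons_descent[OF N ij(1) desc(2) zs(1) zs(2)[folded eq]] by auto
    moreover have "word_eq N ([i, j] @ zs) ([j, i] @ zs)"
      using zs(1) \<open>3 \<le> N\<close> ij 3 by (intro word_eq_append word_eq_commute word_eq_refl) (auto simp: reduced_def)
    then have "word_eq N (i # j # zs) (j # i # zs)" by simp
    ultimately show ?thesis by blast
  qed
qed

text \<open>A Matsumoto-type argument by induction on the length: the first letters of both words
  are descents of the common code, and if they differ, local confluence supplies two intermediate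
  words.\<close>

lemma reduced_word_eq:
  assumes N: "2 \<le> N"
  shows "reduced N xs \<Longrightarrow> reduced N ys \<Longrightarrow> act_list N xs (\<lambda>_. 0) = act_list N ys (\<lambda>_. 0) \<Longrightarrow>
    word_eq N xs ys"
proof (induction "length xs" arbitrary: xs ys rule: less_induct)
  case less
  define c where "c = act_list N xs (\<lambda>_. 0)"
  have len: "length xs = length ys"
    using less.prems by (simp add: reduced_def)
  show ?case
  proof (cases xs)
    case Nil
    then show ?thesis using len by (simp add: word_eq_refl)
  next
    case (Cons i us)
    then obtain j vs where ys: "ys = j # vs" using len by (cases ys) auto
    have i: "i < N" and j: "j < N"
      using less.prems by (auto simp: reduced_def Cons ys)
    have us: "reduced N us" "\<not> descent N i (act_list N us (\<lambda>_. 0))"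
      using less.prems(1) reduced_Cons_iff[OF N i] by (auto simp: Cons)
    have vs: "reduced N vs" "\<not> descent N j (act_list N vs (\<lambda>_. 0))"
      using less.prems(2) reduced_Cons_iff[OF N j] by (auto simp: ys)
    have ci: "c = act N i (act_list N us (\<lambda>_. 0))" and cj: "c = act N j (act_list N vs (\<lambda>_. 0))"
      using less.prems(3) by (simp_all add: c_def Cons ys)
    have di: "descent N i c" "act_list N us (\<lambda>_. 0) = act N i c"
      using us(2) descent_act_iff[OF N i] act_act[OF N i] unfolding ci by simp_all
    have dj: "descent N j c" "act_list N vs (\<lambda>_. 0) = act N j c"
      using vs(2) descent_act_iff[OF N j] act_act[OF N j] unfolding cj by simp_all
    show ?thesis
    proof (cases "i = j")
      case True
      then have "word_eq N us vs"
        using less.hyps[of us vs] us vs di dj by (simp add: Cons)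
      then show ?thesis using i True by (simp add: Cons ys word_eq_Cons)
    next
      case False
      have "c \<in> codes N"
        using less.prems(1) act_list_in_codes[OF N] by (simp add: c_def reduced_def)
      then obtain us' vs' where *: "reduced N us'" "act_list N us' (\<lambda>_. 0) = act N i c"
          "reduced N vs'" "act_list N vs' (\<lambda>_. 0) = act N j c" "word_eq N (i # us') (j # vs')"
        using descents_confluent[OF N i j False di(1) dj(1)] by blast
      \<comment> \<open>The induction hypothesis replaces both tails, giving the chain
        \<open>i # us\<close>, \<open>i # us'\<close>, \<open>j # vs'\<close>,
        \<open>j # vs\<close>.\<close>
      have "word_eq N us us'"
        using less.hyps[of us us'] us * di by (simp add: Cons)
      moreover have "word_eq N vs vs'"
        using less.hyps[of vs vs'] vs * dj len by (simp add: Cons ys)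
      ultimately show ?thesis
        unfolding Cons ys using i j *(5) by (meson word_eq_Cons word_eq_sym word_eq_trans)
    qed
  qed
qed

section \<open>Reduced representatives and length\<close>

lemma neg_letter_rel_pos_letter:
  assumes "i < N"
  shows "([(i, False)], [(i, True)]) \<in> affine_rel N"
proof -
  have "([(i, False)] @ [(i, True), (i, True)], [(i, False)] @ []) \<in> affine_rel N"
    using word_eq_square[OF assms] assms
    by (intro word_rel_append word_rel.refl) (auto simp: word_eq_def)
  moreover have "([] @ [(i, False), (i, \<not> False)] @ [(i, True)], [] @ [(i, True)]) \<in> affine_rel N"
    using assms by (intro word_rel.cancel) auto
  ultimately show ?thesis by (auto intro: word_rel.trans word_rel.sym)
qed

text \<open>Letters are added on the left. A letter that would lower the sum is absorbed, because
  uniqueness lets the reduced word begin with that letter, and the square cancels.\<close>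

lemma word_rel_reduced:
  assumes N: "2 \<le> N"
  shows "u \<in> words {..<N} \<Longrightarrow> \<exists>xs. reduced N xs \<and> (u, pos_word xs) \<in> affine_rel N"
proof (induction u)
  case Nil
  have "reduced N []" by (simp add: reduced_def tuple_sum_def)
  moreover have "([], pos_word []) \<in> affine_rel N" by (simp add: word_rel.refl)
  ultimately show ?case by blast
next
  case (Cons l u)
  obtain i b where l: "l = (i, b)" by (cases l)
  have i: "i < N" using Cons.prems by (simp add: l)
  obtain xs where xs: "reduced N xs" "(u, pos_word xs) \<in> affine_rel N"
    using Cons by auto
  have "([l], [(i, True)]) \<in> affine_rel N"
    using neg_letter_rel_pos_letter[OF i] i by (cases b) (auto simp: l intro: word_rel.refl)
  from word_rel_append[OF this xs(2)] have rel: "(l # u, pos_word (i # xs)) \<in> affine_rel N"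
    by simp
  let ?c = "act_list N xs (\<lambda>_. 0)"
  show ?case
  proof (cases "descent N i ?c")
    case False
    then show ?thesis using rel xs(1) reduced_Cons_iff[OF N i] by blast
  next
    case True
    have "?c \<in> codes N"
      using xs(1) act_list_in_codes[OF N] by (simp add: reduced_def)
    then obtain zs where zs: "reduced N zs" "act_list N zs (\<lambda>_. 0) = act N i ?c"
      using ex_reduced[OF N] act_in_codes[OF N i] by blast
    have "word_eq N xs (i # zs)"
      using reduced_Cons_descent[OF N i True zs] xs(1) by (intro reduced_word_eq[OF N]) auto
    then have "word_eq N (i # xs) ([i, i] @ zs)"
      using word_eq_Cons[OF i] by simp
    also have "word_eq N \<dots> ([] @ zs)"
      using zs(1) i by (intro word_eq_append word_eq_square word_eq_refl) (auto simp: reduced_def)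
    finally have "(l # u, pos_word zs) \<in> affine_rel N"
      using rel by (auto simp: word_eq_def intro: word_rel.trans)
    then show ?thesis using zs(1) by blast
  qed
qed

definition affine_elem :: "nat \<Rightarrow> nat list \<Rightarrow> nat word set" where
  "affine_elem N xs = affine_rel N `` {pos_word xs}"

lemma affine_elem_eq_iff:
  assumes "xs \<in> lists {..<N}" "ys \<in> lists {..<N}"
  shows "affine_elem N xs = affine_elem N ys \<longleftrightarrow> word_eq N xs ys"
  unfolding affine_elem_def word_eq_def using assms by (intro eq_equiv_class_iff[OF equiv_word_rel]) simp_all

lemma affine_elem_in_carrier: "xs \<in> lists {..<N} \<Longrightarrow> affine_elem N xs \<in> carrier (affine_A N)"
  by (auto simp: affine_A_def presented_group_def affine_elem_def intro!: quotientI)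

lemma carrier_affine_A:
  assumes "2 \<le> N"
  shows "carrier (affine_A N) = affine_elem N ` {xs. reduced N xs}"
proof
  show "affine_elem N ` {xs. reduced N xs} \<subseteq> carrier (affine_A N)"
    by (auto simp: reduced_def intro: affine_elem_in_carrier)
  show "carrier (affine_A N) \<subseteq> affine_elem N ` {xs. reduced N xs}"
  proof
    fix g assume "g \<in> carrier (affine_A N)"
    then obtain u where u: "u \<in> words {..<N}" "g = affine_rel N `` {u}"
      by (auto simp: affine_A_def presented_group_def elim: quotientE)
    obtain xs where xs: "reduced N xs" "(u, pos_word xs) \<in> affine_rel N"
      using word_rel_reduced[OF assms u(1)] by blast
    have "g = affine_elem N xs"
      unfolding u(2) affine_elem_def by (rule equiv_class_eq[OF equiv_word_rel xs(2)])
    then show "g \<in> affine_elem N ` {xs. reduced N xs}"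
      using xs(1) by blast
  qed
qed

lemma affine_elem_append:
  assumes "xs \<in> lists {..<N}" "ys \<in> lists {..<N}"
  shows "affine_elem N (xs @ ys) = affine_elem N xs \<otimes>\<^bsub>affine_A N\<^esub> affine_elem N ys"
  using assms by (simp add: affine_elem_def affine_A_def presented_group_mult)

lemma group_list_prod_gens:
  "xs \<in> lists {..<N} \<Longrightarrow> group_list_prod (affine_A N) (map (affine_A_gen N) xs) = affine_elem N xs"
proof (induction xs)
  case Nil
  then show ?case by (simp add: group_list_prod_def affine_elem_def affine_A_def presented_group_def)
next
  case (Cons i xs)
  then have "affine_A_gen N i = affine_elem N [i]"
    by (simp add: affine_A_gen_def presented_gen_def affine_elem_def)
  then show ?case
    using Cons affine_elem_append[of "[i]" N xs] by (simp add: group_list_prod_def)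
qed

text \<open>Any other word for the same element carries 0 to the same code, whose sum is a lower
  bound for the length of that word.\<close>

lemma affine_A_length_reduced:
  assumes N: "2 \<le> N" and xs: "reduced N xs"
  shows "affine_A_length N (affine_elem N xs) = length xs"
  unfolding affine_A_length_def word_length_def
proof (rule Least_equality)
  have mem: "xs \<in> lists {..<N}" using xs by (simp add: reduced_def)
  show "\<exists>gs. gs \<in> lists (affine_A_gen N ` {..<N}) \<and> length gs = length xs \<and>
      group_list_prod (affine_A N) gs = affine_elem N xs"
    using mem by (intro exI[of _ "map (affine_A_gen N) xs"]) (auto simp: lists_image group_list_prod_gens)
  fix k
  assume "\<exists>gs. gs \<in> lists (affine_A_gen N ` {..<N}) \<and> length gs = k \<and>
      group_list_prod (affine_A N) gs = affine_elem N xs"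
  then obtain ys where ys: "ys \<in> lists {..<N}" "length ys = k" "affine_elem N ys = affine_elem N xs"
    by (auto simp: lists_image group_list_prod_gens)
  then have "act_list N ys = act_list N xs"
    using act_list_word_eq[OF N] affine_elem_eq_iff mem by blast
  then show "length xs \<le> k"
    using xs tuple_sum_act_list_le[OF N ys(1)] ys(2) by (simp add: reduced_def)
qed

section \<open>Periodic codes\<close>

text \<open>The pairs of positions are disjoint and all hold the values \<open>(a, b)\<close>, so no
  move disturbs another and all may be performed at once.\<close>

lemma foldr_moves:
  assumes "distinct js" "inj_on p (set js)" "inj_on q (set js)" "p ` set js \<inter> q ` set js = {}"
    and "\<And>j. j \<in> set js \<Longrightarrow> c (p j) = a" "\<And>j. j \<in> set js \<Longrightarrow> c (q j) = b"
  shows "foldr (\<lambda>j. move (p j) (q j)) js c =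
    (\<lambda>x. if x \<in> p ` set js then (if a \<le> b then Suc b else b)
         else if x \<in> q ` set js then (if a \<le> b then a else a - 1) else c x)"
  using assms
proof (induction js)
  case (Cons j js)
  define d where "d = foldr (\<lambda>j. move (p j) (q j)) js c"
  have d: "d = (\<lambda>x. if x \<in> p ` set js then (if a \<le> b then Suc b else b)
         else if x \<in> q ` set js then (if a \<le> b then a else a - 1) else c x)"
    unfolding d_def using Cons.prems by (intro Cons.IH) (auto simp: inj_on_def)
  have notin: "p j \<notin> p ` set js" "p j \<notin> q ` set js" "q j \<notin> p ` set js" "q j \<notin> q ` set js"
    using Cons.prems(1-4) by (auto simp: inj_on_def)
  have pq: "p j \<noteq> q j" using Cons.prems(4) by auto
  have val: "d (p j) = a" "d (q j) = b"
    unfolding d using notin Cons.prems(5,6) by simp_all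
  show ?case
  proof
    fix x
    consider "x = p j" | "x = q j" | "x \<noteq> p j" "x \<noteq> q j" by blast
    then show "foldr (\<lambda>j. move (p j) (q j)) (j # js) c x =
      (if x \<in> p ` set (j # js) then (if a \<le> b then Suc b else b)
       else if x \<in> q ` set (j # js) then (if a \<le> b then a else a - 1) else c x)"
    proof cases
      case 1
      then show ?thesis using pq val by (simp add: move_apply flip: d_def)
    next
      case 2
      then show ?thesis using pq val notin by (simp add: move_apply flip: d_def)
    next
      case 3
      then have "foldr (\<lambda>j. move (p j) (q j)) (j # js) c x = d x"
        by (simp add: move_other flip: d_def)
      then show ?thesis using 3 by (simp add: d)
    qed
  qed
qed simp

definition repeat_tuple :: "nat \<Rightarrow> nat \<Rightarrow> (nat \<Rightarrow> nat) \<Rightarrow> nat \<Rightarrow> nat" where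
  "repeat_tuple n m c x = (if x < m * n then c (x mod n) else 0)"

text \<open>The word obtained by replacing each letter \<open>i\<close> with the \<open>m\<close>
  factors of the image of the generator \<open>i\<close> under the homomorphism.\<close>

definition lift_word :: "nat \<Rightarrow> nat \<Rightarrow> nat list \<Rightarrow> nat list" where
  "lift_word n m xs = concat (map (\<lambda>i. map (\<lambda>j. i + j * n) [0..<m]) xs)"

lemma add_mult_less: "i < n \<Longrightarrow> j < m \<Longrightarrow> i + j * n < m * (n::nat)"
proof -
  assume "i < n" "j < m"
  then have "i + j * n < Suc j * n" by simp
  also have "\<dots> \<le> m * n" using \<open>j < m\<close> by (intro mult_le_mono1) simp
  finally show ?thesis .
qed

text \<open>The \<open>m\<close> letters act on the pairs \<open>(p j, q j)\<close>, which fill the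
  residue classes of \<open>i\<close> and \<open>i + 1\<close> modulo \<open>n\<close>. In a
  repeated tuple all these pairs hold the same two values, so the change repeats the one made by
  \<open>act n i\<close>.\<close>

lemma act_list_residue_class:
  assumes n: "2 \<le> n" and m: "0 < m" and i: "i < n"
  shows "act_list (m * n) (map (\<lambda>j. i + j * n) [0..<m]) (repeat_tuple n m c) =
    repeat_tuple n m (act n i c)"
proof -
  define p where "p j = i + j * n" for j
  define q where "q j = Suc (p j) mod (m * n)" for j
  have p: "p j < m * n" "p j mod n = i" if "j < m" for j
    using add_mult_less[OF i that] i by (simp_all add: p_def)
  have q: "q j < m * n" "q j mod n = Suc i mod n" for j
  proof -
    show "q j < m * n" using n m by (simp add: q_def)
    have "q j mod n = Suc (p j) mod n" by (simp add: q_def mod_mod_cancel)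
    also have "Suc (p j) = Suc i + j * n" by (simp add: p_def)
    also have "\<dots> mod n = Suc i mod n" by (rule mod_mult_self1)
    finally show "q j mod n = Suc i mod n" .
  qed
  have inj_p: "inj_on p {..<m}"
    using n by (auto simp: inj_on_def p_def)
  have inj_q: "inj_on q {..<m}"
  proof (rule inj_onI)
    fix j k assume "j \<in> {..<m}" "k \<in> {..<m}" "q j = q k"
    then show "j = k"
      using Suc_mod_inj[of "p j" "m * n" "p k"] p(1) inj_onD[OF inj_p] by (simp add: q_def)
  qed
  have neq: "Suc i mod n \<noteq> i" by (rule Suc_mod_neq[OF n i])
  have disj: "p ` {..<m} \<inter> q ` {..<m} = {}"
  proof (rule equals0I)
    fix x assume "x \<in> p ` {..<m} \<inter> q ` {..<m}"
    then have "x mod n = i" "x mod n = Suc i mod n" using p(2) q(2) by auto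
    then show False using neq by simp
  qed
  have p_iff: "x \<in> p ` {..<m} \<longleftrightarrow> x mod n = i" if "x < m * n" for x
  proof
    assume "x mod n = i"
    then have "x = p (x div n)" unfolding p_def by (metis mod_div_mult_eq)
    moreover have "x div n < m" using that n by (simp add: less_mult_imp_div_less)
    ultimately show "x \<in> p ` {..<m}" by blast
  qed (use p(2) in auto)
  have q_iff: "x \<in> q ` {..<m} \<longleftrightarrow> x mod n = Suc i mod n" if "x < m * n" for x
  proof
    assume x: "x mod n = Suc i mod n"
    \<comment> \<open>\<open>y\<close> is the cyclic predecessor of \<open>x\<close>; it lies in the
      residue class of \<open>i\<close>, so \<open>p_iff\<close> yields the index \<open>j\<close>
      with \<open>p j = y\<close>.\<close>
    define y where "y = (x + (m * n - 1)) mod (m * n)"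
    have "Suc (x + (m * n - 1)) = x + m * n" using n m by simp
    then have "Suc y mod (m * n) = (x + m * n) mod (m * n)"
      unfolding y_def mod_Suc_eq by (rule arg_cong)
    then have "Suc y mod (m * n) = x" using that by simp
    moreover have "y < m * n" unfolding y_def using n m by simp
    moreover have "y mod n = i"
    proof (rule Suc_mod_inj[OF _ i])
      have "Suc (y mod n) mod n = Suc y mod n" by (simp add: mod_Suc_eq)
      also have "\<dots> = Suc y mod (m * n) mod n" by (simp add: mod_mod_cancel)
      also have "\<dots> = Suc i mod n" using \<open>Suc y mod (m * n) = x\<close> x by simp
      finally show "Suc (y mod n) mod n = Suc i mod n" .
    qed (use n in simp)
    ultimately show "x \<in> q ` {..<m}" using p_iff[of y] unfolding q_def by blast
  qed (use q(2) in auto)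
  have "act_list (m * n) (map p [0..<m]) (repeat_tuple n m c) =
      foldr (\<lambda>j. move (p j) (q j)) [0..<m] (repeat_tuple n m c)"
    by (simp add: foldr_map comp_def act_def q_def)
  also have "\<dots> = (\<lambda>x. if x \<in> p ` set [0..<m]
      then (if c i \<le> c (Suc i mod n) then Suc (c (Suc i mod n)) else c (Suc i mod n))
      else if x \<in> q ` set [0..<m] then (if c i \<le> c (Suc i mod n) then c i else c i - 1)
      else repeat_tuple n m c x)"
    by (rule foldr_moves) (use inj_p inj_q disj p q in \<open>auto simp: repeat_tuple_def lessThan_atLeast0\<close>)
  also have "\<dots> = repeat_tuple n m (act n i c)"
  proof
    fix x
    show "(if x \<in> p ` set [0..<m]
      then (if c i \<le> c (Suc i mod n) then Suc (c (Suc i mod n)) else c (Suc i mod n))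
      else if x \<in> q ` set [0..<m] then (if c i \<le> c (Suc i mod n) then c i else c i - 1)
      else repeat_tuple n m c x) = repeat_tuple n m (act n i c) x"
    proof (cases "x < m * n")
      case True
      then show ?thesis
        using p_iff[OF True] q_iff[OF True] neq
        by (auto simp: repeat_tuple_def act_def move_apply move_other atLeast_upt)
    next
      case False
      then have "x \<notin> p ` {..<m}" "x \<notin> q ` {..<m}" using p q by auto
      then show ?thesis using False by (simp add: repeat_tuple_def atLeast_upt lessThan_atLeast0)
    qed
  qed
  finally show ?thesis unfolding p_def[abs_def] .
qed

lemma tuple_sum_repeat_tuple:
  "tuple_sum (m * n) (repeat_tuple n m c) = m * tuple_sum n c"
proof -
  have block: "(\<Sum>x=j*n..<j*n+n. c (x mod n)) = tuple_sum n c" for j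
    by (simp add: tuple_sum_def sum.atLeastLessThan_shift_0[of _ "j * n"] atLeast0LessThan)
  have "tuple_sum (m * n) (repeat_tuple n m c) = (\<Sum>j<m. \<Sum>x=j*n..<j*n+n. c (x mod n))"
    by (simp add: tuple_sum_def repeat_tuple_def sum.nat_group)
  then show ?thesis by (simp add: block)
qed

lemma lift_word_simps [simp]:
  "lift_word n m [] = []"
  "lift_word n m (i # xs) = map (\<lambda>j. i + j * n) [0..<m] @ lift_word n m xs"
  by (simp_all add: lift_word_def)

lemma length_lift_word: "length (lift_word n m xs) = m * length xs"
  by (induction xs) simp_all

lemma lift_word_in_lists: "xs \<in> lists {..<n} \<Longrightarrow> lift_word n m xs \<in> lists {..<m * n}"
  by (induction xs) (auto simp: add_mult_less)

lemma act_list_lift_word: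
  assumes "2 \<le> n" "0 < m"
  shows "xs \<in> lists {..<n} \<Longrightarrow> act_list (m * n) (lift_word n m xs) (\<lambda>_. 0) =
    repeat_tuple n m (act_list n xs (\<lambda>_. 0))"
proof (induction xs)
  case Nil
  then show ?case by (simp add: repeat_tuple_def fun_eq_iff)
next
  case (Cons i xs)
  then show ?case using act_list_residue_class[OF assms, of i] by simp
qed

text \<open>Passing to the lifted word multiplies both the length of the word and the sum of its
  code by \<open>m\<close>.\<close>

lemma reduced_lift_word:
  assumes "2 \<le> n" "0 < m" "reduced n xs"
  shows "reduced (m * n) (lift_word n m xs)"
  using assms by (simp add: reduced_def lift_word_in_lists act_list_lift_word
      tuple_sum_repeat_tuple length_lift_word)

text \<open>A homomorphism is determined by its values on generators; the letters of a word are
  lifted one by one.\<close>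

lemma hom_affine_elem:
  assumes hom: "\<phi> \<in> hom (affine_A n) (affine_A (m * n))"
    and gen: "\<And>i. i < n \<Longrightarrow> \<phi> (affine_A_gen n i) =
      group_list_prod (affine_A (m * n)) (map (\<lambda>j. affine_A_gen (m * n) (i + j * n)) [0..<m])"
  shows "xs \<in> lists {..<n} \<Longrightarrow> \<phi> (affine_elem n xs) = affine_elem (m * n) (lift_word n m xs)"
proof (induction xs)
  case Nil
  have "\<phi> \<one>\<^bsub>affine_A n\<^esub> = \<one>\<^bsub>affine_A (m * n)\<^esub>"
    by (rule hom_one[OF hom]) (simp_all add: affine_A_def group_presented_group)
  then show ?case by (simp add: affine_elem_def affine_A_def presented_group_def)
next
  case (Cons i xs)
  then have i: "i < n" and xs: "xs \<in> lists {..<n}" by auto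
  have lists: "[i] \<in> lists {..<n}" "map (\<lambda>j. i + j * n) [0..<m] \<in> lists {..<m * n}"
    using i by (auto simp: add_mult_less)
  have "affine_elem n [i] = affine_A_gen n i"
    using i by (simp add: affine_elem_def affine_A_gen_def presented_gen_def)
  then have "\<phi> (affine_elem n [i]) = affine_elem (m * n) (map (\<lambda>j. i + j * n) [0..<m])"
    using gen[OF i] group_list_prod_gens[OF lists(2)] by (simp add: comp_def)
  moreover have "\<phi> (affine_elem n ([i] @ xs)) = \<phi> (affine_elem n [i]) \<otimes>\<^bsub>affine_A (m * n)\<^esub> \<phi> (affine_elem n xs)"
    unfolding affine_elem_append[OF lists(1) xs] using hom affine_elem_in_carrier[OF lists(1)] affine_elem_in_carrier[OF xs]
    by (rule hom_mult)
  ultimately show ?case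
    using Cons.IH[OF xs] affine_elem_append[OF lists(2) lift_word_in_lists[OF xs]] by simp
qed

theorem theorem1p7:
  fixes n m :: nat and \<phi> :: "nat word set \<Rightarrow> nat word set"
  assumes "n \<ge> 2" and "m \<ge> 2"
    and "\<phi> \<in> hom (affine_A n) (affine_A (m * n))"
    and "\<And>i. i < n \<Longrightarrow> \<phi> (affine_A_gen n i) =
      group_list_prod (affine_A (m * n)) (map (\<lambda>j. affine_A_gen (m * n) (i + j * n)) [0..<m])"
  shows "((\<lambda>w. fps_X ^ affine_A_length (m * n) (\<phi> w)) has_sum
      (\<Prod>k=1..n. q_int k (fps_X ^ m)) * (\<Prod>k=2..n. 1 / (1 - fps_X ^ ((k - 1) * m)) :: rat fps))
    (carrier (affine_A n))"
proof -
  have m: "0 < m" and mn: "2 \<le> m * n"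
    using assms(1,2) mult_le_mono[of 1 m 2 n] by auto
  \<comment> \<open>A fixed choice of one reduced word for every code.\<close>
  obtain red where red: "reduced n (red c)" "act_list n (red c) (\<lambda>_. 0) = c" if "c \<in> codes n" for c
    using ex_reduced[OF assms(1)] by metis
  have lists: "red c \<in> lists {..<n}" if "c \<in> codes n" for c
    using red(1)[OF that] by (simp add: reduced_def)
  have image: "\<phi> (affine_elem n xs) = affine_elem (m * n) (lift_word n m xs)" if "xs \<in> lists {..<n}" for xs
    using assms(3) assms(4) that by (rule hom_affine_elem)
  have length: "affine_A_length (m * n) (\<phi> (affine_elem n (red c))) = m * tuple_sum n c" if c: "c \<in> codes n" for c
  proof -
    have "affine_A_length (m * n) (\<phi> (affine_elem n (red c))) = length (lift_word n m (red c))"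
      unfolding image[OF lists[OF c]]
      by (intro affine_A_length_reduced mn reduced_lift_word assms(1) m red(1)[OF c])
    then show ?thesis using red[OF c] by (simp add: length_lift_word reduced_def)
  qed
  \<comment> \<open>Injective because the group element determines the action on 0; surjective
    because reduced words with the same code represent the same element.\<close>
  have bij: "bij_betw (\<lambda>c. affine_elem n (red c)) (codes n) (carrier (affine_A n))"
    unfolding bij_betw_def
  proof
    show "inj_on (\<lambda>c. affine_elem n (red c)) (codes n)"
    proof (rule inj_onI)
      fix c d assume cd: "c \<in> codes n" "d \<in> codes n" and eq: "affine_elem n (red c) = affine_elem n (red d)"
      from eq have "word_eq n (red c) (red d)"
        unfolding affine_elem_eq_iff[OF lists[OF cd(1)] lists[OF cd(2)]] .
      then have "act_list n (red c) = act_list n (red d)"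
        by (rule act_list_word_eq[OF assms(1)])
      then have "act_list n (red c) (\<lambda>_. 0) = act_list n (red d) (\<lambda>_. 0)"
        by (rule arg_cong)
      then show "c = d"
        unfolding red(2)[OF cd(1)] red(2)[OF cd(2)] .
    qed
    show "(\<lambda>c. affine_elem n (red c)) ` codes n = carrier (affine_A n)"
    proof
      show "(\<lambda>c. affine_elem n (red c)) ` codes n \<subseteq> carrier (affine_A n)"
        using lists affine_elem_in_carrier by blast
      show "carrier (affine_A n) \<subseteq> (\<lambda>c. affine_elem n (red c)) ` codes n"
      proof
        fix g assume "g \<in> carrier (affine_A n)"
        then obtain xs where xs: "reduced n xs" "g = affine_elem n xs"
          using carrier_affine_A[OF assms(1)] by blast
        have xs_lists: "xs \<in> lists {..<n}" using xs(1) by (simp add: reduced_def)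
        define c where "c = act_list n xs (\<lambda>_. 0)"
        have c: "c \<in> codes n"
          unfolding c_def by (rule act_list_in_codes[OF assms(1) xs_lists])
        have "word_eq n xs (red c)"
          using xs(1) red[OF c] by (intro reduced_word_eq[OF assms(1)]) (simp_all add: c_def)
        then have "g = affine_elem n (red c)"
          using affine_elem_eq_iff[OF xs_lists lists[OF c]] xs(2) by simp
        then show "g \<in> (\<lambda>c. affine_elem n (red c)) ` codes n" using c by blast
      qed
    qed
  qed
  have "((\<lambda>c. fps_X ^ affine_A_length (m * n) (\<phi> (affine_elem n (red c))) :: rat fps) has_sum
      weight_gf (codes n) (\<lambda>c. m * tuple_sum n c)) (codes n)"
  proof -
    have "finite {c \<in> codes n. m * tuple_sum n c = k}" for k
      by (rule finite_subset[OF _ finite_tuples_tuple_sum[OF m, of n k]]) (auto simp: codes_def)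
    from has_sum_weight_gf[OF this] show ?thesis
      by (subst has_sum_cong[where g = "\<lambda>c. fps_X ^ (m * tuple_sum n c)"]) (simp_all add: length)
  qed
  \<comment> \<open>The sum over codes is transported along \<open>bij\<close> to the group.\<close>
  then have "((\<lambda>w. fps_X ^ affine_A_length (m * n) (\<phi> w) :: rat fps) has_sum
      weight_gf (codes n) (\<lambda>c. m * tuple_sum n c)) (carrier (affine_A n))"
    by (subst has_sum_reindex_bij_betw[OF bij, symmetric])
  then show ?thesis
    using weight_gf_codes_bott[OF m, of n, where 'b=rat] assms(1) by simp
qed

end
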